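(* There exists $\epsilon_0>0$ such that for every $\epsilon$ with $0<\epsilon<\epsilon_0$ the following holds for the random graph $G(n,\tfrac{2}{3})$: $$\lim_{n\rightarrow\infty}P\left(\text{every vertex } v \text{ of } G(n,\tfrac{2}{3}) \text{ satisfies } \deg(v)\in\left[\left(\tfrac{2}{3}-\epsilon\right)n,\ \left(\tfrac{2}{3}+\epsilon\right)n\right]\right)=1.$$
   Context: $G(n,p)$ denotes the Erdős–Rényi random graph: the vertex set is $\{1,2,\ldots,n\}$, and each of the $\binom{n}{2}$ possible edges is present with probability $p$, independently of all other edges. Here $p=\tfrac{2}{3}$ is constant (not depending on $n$). The degree $\deg(v)$ of a vertex $v$ is the number of vertices adjacent to $v$. *)

theory Defs
  imports "HOL-Probability.Probability" "HOL-Probability.Product_PMF" "HOL-Library.Ramsey"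
begin

text \<open>
  A simple graph on the vertex set \<open>{1..n}\<close> is represented by its set of edges, a subset of
  \<open>nsets {1..n} 2\<close>, the set of all two-element sets of vertices.  In \<open>G(n,p)\<close> each potential edge
  carries an independent Bernoulli variable saying whether it is present; the argument \<open>False\<close> of
  \<^const>\<open>Pi_pmf\<close> is merely the value of the product function outside its index set.
  Since \<^const>\<open>bernoulli_pmf\<close> truncates its parameter to the unit interval, \<open>p\<close> is
  meaningful only if \<open>0 \<le> p \<le> 1\<close>.
\<close>

definition gnp :: "nat \<Rightarrow> real \<Rightarrow> nat set set pmf" where
  "gnp n p =
     map_pmf (\<lambda>X. {e \<in> nsets {1..n} 2. X e})
       (Pi_pmf (nsets {1..n} 2) False (\<lambda>_. bernoulli_pmf p))"

definition deg :: "'a set set \<Rightarrow> 'a \<Rightarrow> nat" where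
  "deg E v = card {u. {v, u} \<in> E}"

end

theory Submission
  imports Defs "HOL-Real_Asymp.Real_Asymp"
begin

text \<open>The degree counts the present edges among the \<open>n - 1\<close> potential edges at
  \<open>v\<close>, and these are governed by independent Bernoulli variables with the same
  parameter \<open>p\<close>.\<close>

lemma deg_gnp_binomial:
  assumes v: "v \<in> {1..n}" and p: "p \<in> {0..1}"
  shows "map_pmf (\<lambda>E. deg E v) (gnp n p) = binomial_pmf (n - 1) p"
proof -
  define N where "N = nsets {1..n} 2"
  define A where "A = (\<lambda>u. {v, u}) ` ({1..n} - {v})"
  have inj: "inj_on (\<lambda>u. {v, u}) S" for S
    by (auto simp: inj_on_def doubleton_eq_iff)
  have fin: "finite N"
    unfolding N_def by (intro finite_imp_finite_nsets) simp
  have sub: "A \<subseteq> N"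
    using v by (auto simp: A_def N_def nsets_def)
  have cardA: "card A = n - 1"
    using v by (simp add: A_def card_image[OF inj])
  have deg_eq: "deg {e \<in> N. X e} v = card {e \<in> A. X e}" for X
  proof -
    \<comment> \<open>\<open>deg\<close> lets \<open>u\<close> range over all naturals; lying in
      \<open>N\<close> excludes both \<open>u = v\<close>, where \<open>{v, u}\<close> is a
      singleton, and \<open>u\<close> outside \<open>{1..n}\<close>.\<close>
    have "{v, u} \<in> N \<longleftrightarrow> u \<in> {1..n} - {v}" for u
      using v by (auto simp: N_def nsets_def)
    hence "(\<lambda>u. {v, u}) ` {u. {v, u} \<in> {e \<in> N. X e}} = {e \<in> A. X e}"
      by (auto simp: A_def)
    thus ?thesis
      unfolding deg_def using card_image[OF inj, of "{u. {v, u} \<in> {e \<in> N. X e}}"] by simp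
  qed
  have "binomial_pmf (n - 1) p =
          map_pmf (\<lambda>X. card {e \<in> A. X e}) (Pi_pmf A False (\<lambda>_. bernoulli_pmf p))"
    using finite_subset[OF sub fin] cardA p by (rule binomial_pmf_altdef')
  \<comment> \<open>Restricting the product measure on \<open>N\<close> to the coordinates in
    \<open>A\<close> gives the product measure on \<open>A\<close>, and the count reads only these
    coordinates.\<close>
  also have "\<dots> = map_pmf (\<lambda>X. card {e \<in> A. X e}) (Pi_pmf N False (\<lambda>_. bernoulli_pmf p))"
    by (simp add: Pi_pmf_subset[OF fin sub] map_pmf_comp cong: conj_cong)
  also have "\<dots> = map_pmf (\<lambda>E. deg E v) (gnp n p)"
    unfolding gnp_def N_def[symmetric] map_pmf_comp deg_eq ..
  finally show ?thesis ..
qed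

text \<open>
  The degree has mean \<open>p (n - 1)\<close> rather than \<open>p n\<close>; the discrepancy, at most \<open>1\<close>, is absorbed
  by half of the allowed deviation once \<open>\<epsilon> n \<ge> 2\<close>.
\<close>
lemma prob_deg_gnp_deviation:
  assumes v: "v \<in> {1..n}" and p: "p \<in> {0..1}" and n: "\<epsilon> * real n \<ge> 2" "n \<ge> 2"
  shows "measure_pmf.prob (gnp n p)
           {E. real (deg E v) \<notin> {(p - \<epsilon>) * real n .. (p + \<epsilon>) * real n}}
         \<le> 2 * exp (- (\<epsilon>\<^sup>2 * real n / 2))"
proof -
  interpret binomial_distribution "n - 1" p
    by unfold_locales (rule p)
  define k where "k = \<epsilon> * real n / 2"
  have k: "k \<ge> 1" using n by (simp add: k_def)
  have "measure_pmf.prob (gnp n p)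
          {E. real (deg E v) \<notin> {(p - \<epsilon>) * real n .. (p + \<epsilon>) * real n}}
        = measure_pmf.prob (binomial_pmf (n - 1) p)
            {d. real d \<notin> {(p - \<epsilon>) * real n .. (p + \<epsilon>) * real n}}"
    unfolding deg_gnp_binomial[OF v p, symmetric] by (simp add: vimage_def)
  also have "\<dots> \<le> measure_pmf.prob (binomial_pmf (n - 1) p)
                    {d. \<bar>real d - real (n - 1) * p\<bar> \<ge> k}"
    using k p n by (intro measure_pmf.finite_measure_mono)
      (auto simp: k_def of_nat_diff algebra_simps)
  \<comment> \<open>Two-sided Hoeffding bound for the binomial distribution.\<close>
  also have "\<dots> \<le> 2 * exp (- 2 * k\<^sup>2 / real (n - 1))"
    using k n by (intro prob_abs_ge) auto
  \<comment> \<open>Enlarging the denominator weakens the bound; \<open>n \<ge> 2\<close> keeps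
    \<open>n - 1\<close> positive.\<close>
  also have "\<dots> \<le> 2 * exp (- 2 * k\<^sup>2 / real n)"
    using n by (auto intro!: divide_left_mono simp: of_nat_diff)
  also have "- 2 * k\<^sup>2 / real n = - (\<epsilon>\<^sup>2 * real n / 2)"
    using n by (simp add: k_def field_simps power2_eq_square)
  finally show ?thesis .
qed

text \<open>Degrees of different vertices are dependent through shared edges, but a union bound over
  the \<open>n\<close> vertices suffices because each failure probability is exponentially small in
  \<open>n\<close>.\<close>

lemma gnp_degrees_concentrated:
  assumes p: "p \<in> {0..1}" and \<epsilon>: "\<epsilon> > 0"
  shows "(\<lambda>n. measure_pmf.prob (gnp n p)
            {E. \<forall>v\<in>{1..n}. real (deg E v) \<in> {(p - \<epsilon>) * real n .. (p + \<epsilon>) * real n}})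
         \<longlonglongrightarrow> 1" (is "(\<lambda>n. measure_pmf.prob _ (?G n)) \<longlonglongrightarrow> 1")
proof (rule tendsto_sandwich)
  let ?b = "\<lambda>n. 2 * exp (- (\<epsilon>\<^sup>2 * real n / 2))"
  have "\<forall>\<^sub>F n in sequentially. \<epsilon> * real n \<ge> 2"
    using \<epsilon> by real_asymp
  thus "\<forall>\<^sub>F n in sequentially. 1 - real n * ?b n \<le> measure_pmf.prob (gnp n p) (?G n)"
    using eventually_ge_at_top[of 2]
  proof eventually_elim
    case (elim n)
    let ?B = "\<lambda>v. {E. real (deg E v) \<notin> {(p - \<epsilon>) * real n .. (p + \<epsilon>) * real n}}"
    have "1 - measure_pmf.prob (gnp n p) (?G n) = measure_pmf.prob (gnp n p) (- ?G n)"
      using measure_pmf.prob_compl[of "?G n" "gnp n p"] by (simp only: Compl_eq_Diff_UNIV) simp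
    also have "- ?G n = (\<Union>v\<in>{1..n}. ?B v)"
      by blast
    also have "measure_pmf.prob (gnp n p) \<dots> \<le> (\<Sum>v\<in>{1..n}. measure_pmf.prob (gnp n p) (?B v))"
      by (intro measure_pmf.finite_measure_subadditive_finite) auto
    also have "\<dots> \<le> (\<Sum>v\<in>{1..n}. ?b n)"
      using elim by (intro sum_mono prob_deg_gnp_deviation p)
    finally show ?case
      by simp
  qed
  \<comment> \<open>The exponential decay of \<open>?b n\<close> beats the factor \<open>n\<close>
    from the union bound.\<close>
  show "(\<lambda>n. 1 - real n * ?b n) \<longlonglongrightarrow> 1"
    using \<epsilon> by real_asymp
qed auto

theorem theorem4p7:
  shows "\<exists>\<epsilon>\<^sub>0 > (0::real). \<forall>\<epsilon>. 0 < \<epsilon> \<and> \<epsilon> < \<epsilon>\<^sub>0 \<longrightarrow>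
    (\<lambda>n. measure_pmf.prob (gnp n (2/3))
       {E. \<forall>v\<in>{1..n}. real (deg E v) \<in> {(2/3 - \<epsilon>) * real n .. (2/3 + \<epsilon>) * real n}})
      \<longlonglongrightarrow> 1"
  \<comment> \<open>The witness \<open>1\<close> is an arbitrary positive number, as concentration
    holds at every positive \<epsilon>.\<close>
  by (intro exI[of _ 1] conjI allI impI gnp_degrees_concentrated) auto

end
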